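(* Let $G$ be a finite group. Then the following are equivalent: (i) for every $n\ge1$ and all non-positive $\theta,\pi\in B_n$ (with no condition on $s(\theta)$ and $s(\pi)$), one has $\Pr_\theta(G)=\Pr_\pi(G)=\frac{1}{|G|}$; (ii) $G$ has odd order.
   Context: $B_n$ is the group of permutations $\pi$ of $\{\pm1,\dots,\pm n\}$ with $\pi_{-i}=-\pi_i$. $m(\pi)$ is the number of $1\le i\le n$ with $\pi_i<0$; $\pi$ is non-positive if $m(\pi)>0$. For $\pi\in B_n$, $\Pr_\pi(G)$ is the probability, over independent uniformly random $a_1,\dots,a_n\in G$, that $a_1\cdots a_n=a_{|\pi_1|}^{\epsilon_1}\cdots a_{|\pi_n|}^{\epsilon_n}$, where $\epsilon_i=1$ if $\pi_i>0$ and $\epsilon_i=-1$ if $\pi_i<0$. ($s(\pi)$ denotes the number of alternating cycles in the breakpoint graph of $\pi$; it plays no role in the conditions.) *)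

theory Defs
  imports "HOL-Algebra.Coset" "HOL-Combinatorics.Permutations"
    "HOL-Probability.Product_PMF"
begin

text \<open>Signed permutations are total functions on \<^typ>\<open>int\<close> that fix everything outside
  \<open>{\<plusminus>1, \<dots>, \<plusminus>n}\<close> (the convention of \<^const>\<open>permutes\<close>), so that equality of
  functions is equality of signed permutations.\<close>

definition signed_perms :: "nat \<Rightarrow> (int \<Rightarrow> int) set" where
  "signed_perms n =
     {\<pi>. \<pi> permutes ({- int n..int n} - {0}) \<and>
          (\<forall>i \<in> {- int n..int n} - {0}. \<pi> (- i) = - \<pi> i)}"

definition num_neg :: "nat \<Rightarrow> (int \<Rightarrow> int) \<Rightarrow> nat" where
  "num_neg n \<pi> = card {i \<in> {1..int n}. \<pi> i < 0}"

definition non_positive :: "nat \<Rightarrow> (int \<Rightarrow> int) \<Rightarrow> bool" where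
  "non_positive n \<pi> \<longleftrightarrow> num_neg n \<pi> > 0"

definition sign_exp :: "(int \<Rightarrow> int) \<Rightarrow> int \<Rightarrow> int" where
  "sign_exp \<pi> i = (if \<pi> i > 0 then 1 else - 1)"

text \<open>The product \<open>f 1 \<otimes> f 2 \<otimes> \<dots> \<otimes> f n\<close> in this order; \<open>finprod\<close>
  is for commutative monoids only.\<close>

definition ordered_prod :: "('a, 'b) monoid_scheme \<Rightarrow> nat \<Rightarrow> (int \<Rightarrow> 'a) \<Rightarrow> 'a" where
  "ordered_prod G n f = foldr (\<otimes>\<^bsub>G\<^esub>) (map f [1..int n]) \<one>\<^bsub>G\<^esub>"

definition perm_prob :: "('a, 'b) monoid_scheme \<Rightarrow> nat \<Rightarrow> (int \<Rightarrow> int) \<Rightarrow> real" where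
  "perm_prob G n \<pi> =
     measure_pmf.prob (Pi_pmf {1..int n} undefined (\<lambda>_. pmf_of_set (carrier G)))
       {a. ordered_prod G n a =
           ordered_prod G n (\<lambda>i. a \<bar>\<pi> i\<bar> [^]\<^bsub>G\<^esub> sign_exp \<pi> i)}"

end

theory Submission imports Defs "HOL-Algebra.Multiplicative_Group" begin

text \<open>If \<open>\<pi> i < 0\<close>, put \<open>j = - \<pi> i\<close> and fix all letters other than \<open>a j = x\<close>. The equation then
  reads \<open>p x q = r x\<inverse> s\<close>, which for \<open>c = q s\<inverse>\<close> is \<open>(x c)\<^sup>2 = p\<inverse> r c\<close>. In a group of odd
  order every element has exactly one square root, so exactly one \<open>x\<close> solves it, whatever the
  other letters are. Conversely, for \<open>n = 1\<close> and \<open>\<pi> = -1\<close> the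
  condition says that \<open>a = a\<inverse>\<close> has exactly one solution, so inversion pairs off the
  non-identity elements.\<close>

text \<open>The orbits \<open>{x, h x}\<close> split \<open>X\<close> into pairs. The induction
  removes one orbit at a time; what is left is still closed under \<open>h\<close>.\<close>

lemma even_card_fixpoint_free_involution:
  assumes "finite X"
    and "\<And>x. x \<in> X \<Longrightarrow> h x \<in> X" "\<And>x. x \<in> X \<Longrightarrow> h (h x) = x" "\<And>x. x \<in> X \<Longrightarrow> h x \<noteq> x"
  shows "even (card X)"
  using assms
proof (induction X rule: finite_psubset_induct)
  case (psubset X)
  show ?case
  proof (cases "X = {}")
    case False
    then obtain x where x: "x \<in> X" by blast
    let ?Y = "X - {x, h x}"
    have "even (card ?Y)"
    proof (rule psubset.IH)
      show "?Y \<subset> X" using x by blast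
      show "h y \<in> ?Y" if "y \<in> ?Y" for y
        using that x psubset.prems(1,2) by auto metis+
    qed (use psubset.prems in auto)
    moreover have "card X = card ?Y + 2"
    proof -
      have "{x, h x} \<subseteq> X" "card {x, h x} = 2"
        using x psubset.prems(1) psubset.prems(3)[OF x] by (auto simp: eq_commute)
      then show ?thesis
        using psubset.hyps by (metis card_Diff_subset card_mono finite_subset le_add_diff_inverse2)
    qed
    ultimately show ?thesis by simp
  qed simp
qed

text \<open>Coordinates are independent, so the probability of \<open>E\<close> is the average, over
  all the other coordinates, of its conditional probability with only coordinate \<open>j\<close>
  random. If that conditional probability is always \<open>c\<close>, so is the average.\<close>

lemma prob_Pi_pmf_condition_coordinate:
  assumes "finite I" "j \<in> I"
    and "\<And>f. f \<in> PiE_dflt (I - {j}) d (set_pmf \<circ> p) \<Longrightarrow>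
           measure_pmf.prob (p j) {x. f(j := x) \<in> E} = c"
  shows "measure_pmf.prob (Pi_pmf I d p) E = c"
proof -
  let ?M = "Pi_pmf (I - {j}) d p"
  have "Pi_pmf I d p = Pi_pmf (insert j (I - {j})) d p"
    using assms(2) by (simp add: insert_absorb)
  \<comment> \<open>\<open>Pi_pmf_insert'\<close> draws coordinate \<open>j\<close> first; commuting
    the two draws makes it the last one, with \<open>f\<close> already fixed.\<close>
  also have "\<dots> = bind_pmf ?M (\<lambda>f. map_pmf (\<lambda>x. f(j := x)) (p j))"
    using assms(1) by (subst Pi_pmf_insert', simp, simp, subst bind_commute_pmf)
      (simp add: map_pmf_def)
  finally have "emeasure (Pi_pmf I d p) E
      = (\<integral>\<^sup>+f. emeasure (map_pmf (\<lambda>x. f(j := x)) (p j)) E \<partial>?M)"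
    by simp
  also have "\<dots> = (\<integral>\<^sup>+f. ennreal c \<partial>?M)"
  proof (rule nn_integral_cong_AE, rule AE_pmfI)
    fix f assume "f \<in> set_pmf ?M"
    then have "f \<in> PiE_dflt (I - {j}) d (set_pmf \<circ> p)"
      using assms(1) by (simp add: set_Pi_pmf)
    from assms(3)[OF this]
    show "emeasure (map_pmf (\<lambda>x. f(j := x)) (p j)) E = ennreal c"
      by (simp add: measure_pmf.emeasure_eq_measure vimage_def)
  qed
  also have "\<dots> = ennreal c" by simp
  finally have "ennreal (measure_pmf.prob (Pi_pmf I d p) E) = ennreal c"
    by (simp add: measure_pmf.emeasure_eq_measure)
  \<comment> \<open>\<open>ennreal\<close> sends all negative reals to 0, so the equation descends
    to the reals only for nonnegative \<open>c\<close>. Any \<open>f\<close> in the support exhibits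
    \<open>c\<close> as a probability.\<close>
  moreover have "0 \<le> c"
  proof -
    obtain f where "f \<in> set_pmf ?M" using set_pmf_not_empty[of ?M] by blast
    then have "f \<in> PiE_dflt (I - {j}) d (set_pmf \<circ> p)"
      using assms(1) by (simp add: set_Pi_pmf)
    from assms(3)[OF this] show ?thesis by (metis measure_nonneg)
  qed
  ultimately show ?thesis by simp
qed

context group
begin

lemma foldr_mult_closed:
  assumes "set xs \<subseteq> carrier G"
  shows "foldr (\<otimes>) xs \<one> \<in> carrier G"
  using assms by (induction xs) auto

lemma foldr_mult_append:
  assumes "set xs \<subseteq> carrier G" "set ys \<subseteq> carrier G"
  shows "foldr (\<otimes>) (xs @ ys) \<one> = foldr (\<otimes>) xs \<one> \<otimes> foldr (\<otimes>) ys \<one>"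
  using assms by (induction xs) (auto simp: foldr_mult_closed m_assoc)

text \<open>Isolates one factor, so that the letter chosen as the unknown can be exposed on either
  side of the word equation.\<close>

lemma ordered_prod_split:
  assumes "k \<in> {1..int n}" "f \<in> {1..int n} \<rightarrow> carrier G"
  shows "ordered_prod G n f =
    foldr (\<otimes>) (map f [1..k - 1]) \<one> \<otimes> (f k \<otimes> foldr (\<otimes>) (map f [k + 1..int n]) \<one>)"
proof -
  have "[1..int n] = [1..k - 1] @ k # [k + 1..int n]"
    using assms(1) by (intro upto_split3) auto
  then show ?thesis
    using assms unfolding ordered_prod_def
    by (simp only: map_append list.map, subst foldr_mult_append) (auto simp: Pi_iff)
qed

text \<open>If the order is \<open>2 * k + 1\<close>, raising to the power \<open>k + 1\<close>
  undoes squaring by Lagrange's theorem. Hence \<open>y [^] (k + 1)\<close> is the only candidate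
  for a root of \<open>y\<close>.\<close>

lemma odd_order_ex1_sqrt:
  assumes "finite (carrier G)" "odd (Coset.order G)" "y \<in> carrier G"
  shows "\<exists>!x. x \<in> carrier G \<and> x \<otimes> x = y"
proof -
  from assms(2) obtain k where k: "Coset.order G = 2 * k + 1" by (auto elim: oddE)
  have root: "(x \<otimes> x) [^] (k + 1) = x" if "x \<in> carrier G" for x
  proof -
    have "(x \<otimes> x) [^] (k + 1) = (x [^] (2::nat)) [^] (k + 1)"
      using that by (simp add: numeral_2_eq_2)
    also have "\<dots> = x [^] (Coset.order G + 1)"
      using that by (subst nat_pow_pow) (auto simp: k)
    also have "\<dots> = x"
      using that pow_order_eq_1[OF that] by simp
    finally show ?thesis .
  qed
  \<comment> \<open>The candidate is a root: \<open>y\<close> commutes with itself, so the product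
    of the powers is \<open>(y \<otimes> y) [^] (k + 1)\<close>.\<close>
  have "y [^] (k + 1) \<otimes> y [^] (k + 1) = y"
    using root[OF assms(3)] assms(3) pow_mult_distrib[of y y "k + 1"] by metis
  then show ?thesis
    using root assms(3) by (metis nat_pow_closed)
qed

text \<open>Completing the square: right translation by \<open>?c\<close> is a bijection of the
  group, and it turns solutions of the equation into square roots of a fixed element.\<close>

lemma odd_order_ex1_solution:
  assumes "finite (carrier G)" "odd (Coset.order G)"
    and [simp]: "p \<in> carrier G" "q \<in> carrier G" "r \<in> carrier G" "s \<in> carrier G"
  shows "\<exists>!x. x \<in> carrier G \<and> p \<otimes> (x \<otimes> q) = r \<otimes> (inv x \<otimes> s)"
proof -
  let ?c = "q \<otimes> inv s"
  have eq: "p \<otimes> (x \<otimes> q) = r \<otimes> (inv x \<otimes> s) \<longleftrightarrow>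
      (x \<otimes> ?c) \<otimes> (x \<otimes> ?c) = inv p \<otimes> r \<otimes> ?c" if [simp]: "x \<in> carrier G" for x
  proof -
    have "p \<otimes> (x \<otimes> q) = r \<otimes> (inv x \<otimes> s) \<longleftrightarrow> x \<otimes> q = inv p \<otimes> (r \<otimes> (inv x \<otimes> s))"
      by (subst inv_solve_left) auto
    also have "\<dots> \<longleftrightarrow> x \<otimes> q = (inv p \<otimes> r \<otimes> inv x) \<otimes> s"
      by (simp add: m_assoc)
    also have "\<dots> \<longleftrightarrow> x \<otimes> q \<otimes> inv s = inv p \<otimes> r \<otimes> inv x"
      by (simp add: inv_solve_right')
    also have "\<dots> \<longleftrightarrow> x \<otimes> ?c \<otimes> x = inv p \<otimes> r"
      by (subst inv_solve_right) (auto simp: m_assoc)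
    also have "\<dots> \<longleftrightarrow> x \<otimes> ?c \<otimes> x \<otimes> ?c = inv p \<otimes> r \<otimes> ?c"
      by (subst right_cancel) simp_all
    finally show ?thesis by (simp add: m_assoc)
  qed
  have "\<exists>!y. y \<in> carrier G \<and> y \<otimes> y = inv p \<otimes> r \<otimes> ?c"
    using assms(1,2) by (intro odd_order_ex1_sqrt) auto
  then obtain y where y: "y \<in> carrier G" "y \<otimes> y = inv p \<otimes> r \<otimes> ?c"
    and uniq: "\<And>z. z \<in> carrier G \<Longrightarrow> z \<otimes> z = inv p \<otimes> r \<otimes> ?c \<Longrightarrow> z = y"
    by blast
  show ?thesis
  proof (intro ex1I conjI)
    \<comment> \<open>The witness translates the unique root \<open>y\<close> back.\<close>
    show "y \<otimes> inv ?c \<in> carrier G" using y by simp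
    have "y \<otimes> inv ?c \<otimes> ?c = y" using y by (subst m_assoc) auto
    then show "p \<otimes> ((y \<otimes> inv ?c) \<otimes> q) = r \<otimes> (inv (y \<otimes> inv ?c) \<otimes> s)"
      using y by (subst eq) auto
    fix x assume "x \<in> carrier G \<and> p \<otimes> (x \<otimes> q) = r \<otimes> (inv x \<otimes> s)"
    then have "x \<in> carrier G" "x \<otimes> ?c = y" using eq uniq by auto
    then show "x = y \<otimes> inv ?c" using y by (subst inv_solve_right) auto
  qed
qed

text \<open>Once all letters but one that occurs inverted are fixed, exactly one value of that
  letter solves the equation, so each conditional probability is one over the order.\<close>

lemma perm_prob_odd_order:
  assumes fin: "finite (carrier G)" and odd: "odd (Coset.order G)"
    and \<pi>: "\<pi> \<in> signed_perms n" and neg: "non_positive n \<pi>"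
  shows "perm_prob G n \<pi> = 1 / real (Coset.order G)"
proof -
  let ?D = "{- int n..int n} - {0}"
  have perm: "\<pi> permutes ?D" and odd_\<pi>: "\<And>i. i \<in> ?D \<Longrightarrow> \<pi> (- i) = - \<pi> i"
    using \<pi> by (auto simp: signed_perms_def)
  have abs_mem: "\<bar>\<pi> i\<bar> \<in> {1..int n}" if "i \<in> {1..int n}" for i
  proof -
    have "i \<in> ?D" using that by auto
    then have "\<pi> i \<in> ?D" using permutes_in_image[OF perm] by blast
    then show ?thesis by auto
  qed
  obtain k where k: "k \<in> {1..int n}" "\<pi> k < 0"
    using neg unfolding non_positive_def num_neg_def
    by (metis (mono_tags, lifting) card_gt_0_iff ex_in_conv mem_Collect_eq)
  \<comment> \<open>The unknown is the letter with index \<open>j\<close>: it stands at place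
    \<open>j\<close> on the left and, inverted, at place \<open>k\<close> on the right.\<close>
  define j where "j = - \<pi> k"
  have j: "j \<in> {1..int n}" using abs_mem[OF k(1)] k(2) by (simp add: j_def)
  have uniq: "\<bar>\<pi> i\<bar> \<noteq> j" if i: "i \<in> {1..int n}" "i \<noteq> k" for i
  proof
    assume "\<bar>\<pi> i\<bar> = j"
    \<comment> \<open>Oddness of \<pi> rewrites \<open>- \<pi> k\<close> as
      \<open>\<pi> (- k)\<close>, so injectivity applies to both signs; \<open>i = - k\<close> then
      fails because both are positive.\<close>
    then have "\<pi> i = \<pi> k \<or> \<pi> i = \<pi> (- k)"
      using k odd_\<pi>[of k] by (auto simp: j_def)
    then have "i = k \<or> i = - k"
      using permutes_inj[OF perm] by (auto simp: inj_def)
    then show False using i k by auto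
  qed
  let ?E = "{a. ordered_prod G n a = ordered_prod G n (\<lambda>i. a \<bar>\<pi> i\<bar> [^] sign_exp \<pi> i)}"
  have ne: "carrier G \<noteq> {}" by blast
  have "measure_pmf.prob (pmf_of_set (carrier G)) {x. f(j := x) \<in> ?E} = 1 / real (Coset.order G)"
    if f: "f \<in> PiE_dflt ({1..int n} - {j}) undefined (set_pmf \<circ> (\<lambda>_. pmf_of_set (carrier G)))" for f
  proof -
    \<comment> \<open>\<open>f j\<close> is the default \<open>undefined\<close>, which need not lie
      in the group. Among the places from 1 to \<open>n\<close>, only \<open>?g k\<close> reads it,
      and the products \<open>?r\<close> and \<open>?s\<close> skip place \<open>k\<close>.\<close>
    let ?g = "\<lambda>i. f \<bar>\<pi> i\<bar> [^] sign_exp \<pi> i"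
    let ?p = "foldr (\<otimes>) (map f [1..j - 1]) \<one>" and ?q = "foldr (\<otimes>) (map f [j + 1..int n]) \<one>"
    let ?r = "foldr (\<otimes>) (map ?g [1..k - 1]) \<one>" and ?s = "foldr (\<otimes>) (map ?g [k + 1..int n]) \<one>"
    have fc: "f i \<in> carrier G" if "i \<in> {1..int n}" "i \<noteq> j" for i
      using f that fin ne by (auto simp: PiE_dflt_def)
    have gc: "?g i \<in> carrier G" if "i \<in> {1..int n}" "i \<noteq> k" for i
      using fc[OF abs_mem[OF that(1)] uniq[OF that]] by simp
    have lhs: "ordered_prod G n (f(j := x)) = ?p \<otimes> (x \<otimes> ?q)" if x: "x \<in> carrier G" for x
    proof -
      have "map (f(j := x)) [1..j - 1] = map f [1..j - 1]"
        "map (f(j := x)) [j + 1..int n] = map f [j + 1..int n]" by auto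
      then show ?thesis
        using x fc by (subst ordered_prod_split[OF j]) auto
    qed
    have rhs: "ordered_prod G n (\<lambda>i. (f(j := x)) \<bar>\<pi> i\<bar> [^] sign_exp \<pi> i) = ?r \<otimes> (inv x \<otimes> ?s)"
      (is "ordered_prod G n ?h = _") if x: "x \<in> carrier G" for x
    proof -
      have hk: "?h k = inv x"
        using k x by (simp add: j_def sign_exp_def int_pow_neg)
      have hg: "?h i = ?g i" if "i \<in> {1..int n}" "i \<noteq> k" for i
        using uniq[OF that] by simp
      have "?h i \<in> carrier G" if "i \<in> {1..int n}" for i
        using hk hg gc that x by (cases "i = k") auto
      then have "ordered_prod G n ?h =
          foldr (\<otimes>) (map ?h [1..k - 1]) \<one> \<otimes> (?h k \<otimes> foldr (\<otimes>) (map ?h [k + 1..int n]) \<one>)"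
        by (intro ordered_prod_split[OF k(1)]) blast
      moreover have "map ?h [1..k - 1] = map ?g [1..k - 1]"
        using k by (intro map_cong refl hg) auto
      moreover have "map ?h [k + 1..int n] = map ?g [k + 1..int n]"
        using k by (intro map_cong refl hg) auto
      ultimately show ?thesis by (simp only: hk)
    qed
    have "?p \<in> carrier G" "?q \<in> carrier G"
      using j fc by (auto intro!: foldr_mult_closed)
    moreover have "?r \<in> carrier G" "?s \<in> carrier G"
      using k gc by (auto intro!: foldr_mult_closed)
    ultimately have "\<exists>!x. x \<in> carrier G \<and> ?p \<otimes> (x \<otimes> ?q) = ?r \<otimes> (inv x \<otimes> ?s)"
      by (intro odd_order_ex1_solution fin odd)
    then obtain x0 where x0: "{x \<in> carrier G. ?p \<otimes> (x \<otimes> ?q) = ?r \<otimes> (inv x \<otimes> ?s)} = {x0}"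
      by (elim ex1E) blast
    have "carrier G \<inter> {x. f(j := x) \<in> ?E} =
        {x \<in> carrier G. ?p \<otimes> (x \<otimes> ?q) = ?r \<otimes> (inv x \<otimes> ?s)}"
      unfolding Int_def mem_Collect_eq by (intro Collect_cong conj_cong refl) (simp only: lhs rhs)
    then have "card (carrier G \<inter> {x. f(j := x) \<in> ?E}) = 1"
      unfolding x0 by simp
    then show ?thesis
      unfolding measure_pmf_of_set[OF ne fin] by (simp only: Coset.order_def of_nat_1)
  qed
  then show ?thesis
    unfolding perm_prob_def
    by (intro prob_Pi_pmf_condition_coordinate[where j = j] j) auto
qed

text \<open>With a single letter the word equation is \<open>a = inv a\<close>, so the favourable
  outcomes are the self-inverse elements, the identity among them.\<close>

lemma perm_prob_single_neg:
  assumes fin: "finite (carrier G)" and \<pi>: "\<pi> 1 = - 1"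
  shows "perm_prob G 1 \<pi> = real (card {a \<in> carrier G. inv a = a}) / real (Coset.order G)"
proof -
  have ne: "carrier G \<noteq> {}" by blast
  have "perm_prob G 1 \<pi> = measure_pmf.prob (pmf_of_set (carrier G))
      {x. x \<otimes> \<one> = x [^] (- 1 :: int) \<otimes> \<one>}"
    using \<pi> by (simp add: perm_prob_def Pi_pmf_singleton ordered_prod_def sign_exp_def vimage_def)
  moreover have "carrier G \<inter> {x. x \<otimes> \<one> = x [^] (- 1 :: int) \<otimes> \<one>} = {a \<in> carrier G. inv a = a}"
    by (auto simp: int_pow_neg)
  ultimately show ?thesis
    using fin ne by (simp add: measure_pmf_of_set Coset.order_def)
qed

text \<open>The identity is self-inverse, hence the only such element, and inversion is a
  fixed-point-free involution on the rest.\<close>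

lemma odd_order_if_no_involution:
  assumes fin: "finite (carrier G)" and one: "card {a \<in> carrier G. inv a = a} = 1"
  shows "odd (Coset.order G)"
proof -
  obtain b where "{a \<in> carrier G. inv a = a} = {b}"
    using one by (rule card_1_singletonE)
  moreover have "\<one> \<in> {a \<in> carrier G. inv a = a}" by simp
  ultimately have only: "{a \<in> carrier G. inv a = a} = {\<one>}" by simp
  have "even (card (carrier G - {\<one>}))"
    using fin only by (intro even_card_fixpoint_free_involution[where h = "\<lambda>a. inv a"]) auto
  moreover have "Coset.order G = Suc (card (carrier G - {\<one>}))"
    unfolding Coset.order_def using fin by (intro card.remove) auto
  ultimately show ?thesis by simp
qed

end

theorem corollary5p8:
  fixes G :: "('a, 'b) monoid_scheme"
  assumes "group G" and "finite (carrier G)"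
  shows "(\<forall>n\<ge>1. \<forall>\<theta>\<in>signed_perms n. \<forall>\<pi>\<in>signed_perms n.
            non_positive n \<theta> \<longrightarrow> non_positive n \<pi> \<longrightarrow>
              perm_prob G n \<theta> = perm_prob G n \<pi> \<and>
              perm_prob G n \<pi> = 1 / real (Coset.order G))
         \<longleftrightarrow> odd (Coset.order G)"
    (is "?L \<longleftrightarrow> _")
proof
  interpret group G by fact
  assume L: ?L
  \<comment> \<open>The sign change in \<open>signed_perms 1\<close>; a transposition fixes all
    other integers, as the encoding demands.\<close>
  define \<pi> :: "int \<Rightarrow> int" where "\<pi> = Transposition.transpose 1 (- 1)"
  have "{- int 1..int 1} - {0} = {- 1, 1}" by auto
  then have "\<pi> \<in> signed_perms 1"
    unfolding signed_perms_def \<pi>_def by (auto intro: permutes_swap_id)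
  moreover have "{i \<in> {1..int 1}. \<pi> i < 0} = {1}" by (auto simp: \<pi>_def)
  then have "non_positive 1 \<pi>" by (simp add: non_positive_def num_neg_def)
  ultimately have "perm_prob G 1 \<pi> = 1 / real (Coset.order G)" using L by blast
  moreover have "\<pi> 1 = - 1" by (simp add: \<pi>_def)
  ultimately have "real (card {a \<in> carrier G. inv\<^bsub>G\<^esub> a = a}) / real (Coset.order G) = 1 / real (Coset.order G)"
    using perm_prob_single_neg[OF assms(2)] by metis
  moreover have "Coset.order G > 0" using assms(2) order_gt_0_iff_finite by blast
  ultimately have "card {a \<in> carrier G. inv\<^bsub>G\<^esub> a = a} = 1" by simp
  then show "odd (Coset.order G)" by (rule odd_order_if_no_involution[OF assms(2)])
next
  interpret group G by fact
  assume "odd (Coset.order G)"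
  then show ?L using perm_prob_odd_order[OF assms(2)] by simp
qed

end
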